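(* Let $\mathcal{N}_{3,4}$ be the set of all inertias $\operatorname{In}(\rho^\Gamma)$, where $\rho$ ranges over all $12\times 12$ complex positive semidefinite matrices on $\mathbb{C}^3\otimes\mathbb{C}^4$ such that $\rho^\Gamma$ has at least one negative eigenvalue. Then: (i) $(7,0,5)\notin\mathcal{N}_{3,4}$. (ii) $(7,1,4)\notin\mathcal{N}_{3,4}$ and $(7,2,3)\notin\mathcal{N}_{3,4}$. (iii) $(8,0,4)\notin\mathcal{N}_{3,4}$, $(8,1,3)\notin\mathcal{N}_{3,4}$ and $(9,0,3)\notin\mathcal{N}_{3,4}$.
   Context: For a Hermitian matrix $H$, the inertia is $\operatorname{In}(H)=(a,b,c)$, where $a,b,c$ are the numbers (with multiplicity) of negative, zero and positive eigenvalues of $H$, in this order. A matrix $M\in\mathbb{C}^{mn\times mn}$ on $\mathbb{C}^m\otimes\mathbb{C}^n$ is written as an $m\times m$ block matrix $M=[M_{ij}]$ with blocks $M_{ij}\in\mathbb{C}^{n\times n}$; its partial transpose (on the first system) is $M^\Gamma=[M_{ji}]$, i.e. the block matrix whose $(i,j)$ block is $M_{ji}$. *)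

theory Defs
  imports
    "Jordan_Normal_Form.Char_Poly"
    "Jordan_Normal_Form.Schur_Decomposition"
begin

definition hermitian_mat :: "complex mat \<Rightarrow> bool" where
  "hermitian_mat A \<longleftrightarrow> square_mat A \<and> mat_adjoint A = A"

(* (A *\<^sub>v v) \<bullet>c v is v* A v.  The order on complex numbers is the partial order for which
   0 \<le> z says that z is real and nonnegative. *)
definition psd_mat :: "complex mat \<Rightarrow> bool" where
  "psd_mat A \<longleftrightarrow> hermitian_mat A \<and>
     (\<forall>v \<in> carrier_vec (dim_row A). 0 \<le> (A *\<^sub>v v) \<bullet>c v)"

(* Numbers of negative, zero and positive eigenvalues, in this order, counted with their
   multiplicities as roots of the characteristic polynomial.  Meant for Hermitian H, whose
   eigenvalues are all real; only real eigenvalues are counted. *)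
definition inertia :: "complex mat \<Rightarrow> nat \<times> nat \<times> nat" where
  "inertia H =
    ((\<Sum>x | eigenvalue H (complex_of_real x) \<and> x < 0. order (complex_of_real x) (char_poly H)),
     (\<Sum>x | eigenvalue H (complex_of_real x) \<and> x = 0. order (complex_of_real x) (char_poly H)),
     (\<Sum>x | eigenvalue H (complex_of_real x) \<and> x > 0. order (complex_of_real x) (char_poly H)))"

(* The n x n block in block row i and block column j; all indices start at 0. *)
definition block :: "nat \<Rightarrow> 'a mat \<Rightarrow> nat \<Rightarrow> nat \<Rightarrow> 'a mat" where
  "block n M i j = mat n n (\<lambda>(k, l). M $$ (i * n + k, j * n + l))"

definition partial_transpose :: "nat \<Rightarrow> nat \<Rightarrow> 'a mat \<Rightarrow> 'a mat" where
  "partial_transpose m n M =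
    mat (m * n) (m * n) (\<lambda>(r, c). block n M (c div n) (r div n) $$ (r mod n, c mod n))"

lemma partial_transpose_carrier [simp]:
  "partial_transpose m n M \<in> carrier_mat (m * n) (m * n)"
  by (simp add: partial_transpose_def)

lemma block_partial_transpose:
  assumes "i < m" "j < m"
  shows "block n (partial_transpose m n M) i j = block n M j i"
proof (rule eq_matI)
  fix k l
  assume "k < dim_row (block n M j i)" "l < dim_col (block n M j i)"
  then have kl: "k < n" "l < n"
    by (simp_all add: block_def)
  have bound: "a * n + b < m * n" if "a < m" "b < n" for a b
  proof -
    have "a * n + b < Suc a * n" using that by simp
    also have "\<dots> \<le> m * n" using that by (intro mult_le_mono1) simp
    finally show ?thesis .
  qed
  show "block n (partial_transpose m n M) i j $$ (k, l) = block n M j i $$ (k, l)"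
    using kl bound[of i k] bound[of j l] assms
    by (simp add: block_def partial_transpose_def)
qed (simp_all add: block_def)

lemma hermitian_partial_transpose:
  assumes M: "M \<in> carrier_mat (m * n) (m * n)" and herm: "hermitian_mat M"
  shows "hermitian_mat (partial_transpose m n M)"
proof -
  have adj: "mat_adjoint A $$ (r, c) = cnj (A $$ (c, r))"
    if "r < dim_col A" "c < dim_row A" for A :: "complex mat" and r c
    using that by (simp add: mat_adjoint_def mat_of_rows_def)
  have sym: "cnj (M $$ (c, r)) = M $$ (r, c)" if "r < m * n" "c < m * n" for r c
    using adj[of r M c] that M herm by (auto simp: hermitian_mat_def)
  have bound: "a div n * n + b mod n < m * n" if "a < m * n" "b < m * n" for a b
  proof -
    have n: "n > 0" using that by (cases n) auto
    have "a div n < m" using that by (simp add: less_mult_imp_div_less)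
    then have "Suc (a div n) * n \<le> m * n" by (intro mult_le_mono1) simp
    moreover have "b mod n < n" using n by simp
    ultimately show ?thesis by simp
  qed
  let ?P = "partial_transpose m n M"
  have "mat_adjoint ?P = ?P"
  proof (rule eq_matI)
    fix r c
    assume "r < dim_row ?P" "c < dim_col ?P"
    then have rc: "r < m * n" "c < m * n" by (simp_all add: partial_transpose_def)
    then have "n > 0" by (cases n) auto
    then have mods: "r mod n < n" "c mod n < n" by simp_all
    have "mat_adjoint ?P $$ (r, c) = cnj (?P $$ (c, r))"
      using rc by (intro adj) (simp_all add: partial_transpose_def)
    also have "\<dots> = cnj (M $$ (r div n * n + c mod n, c div n * n + r mod n))"
      using rc mods by (simp add: partial_transpose_def block_def)
    also have "\<dots> = M $$ (c div n * n + r mod n, r div n * n + c mod n)"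
      using rc by (intro sym bound)
    also have "\<dots> = ?P $$ (r, c)"
      using rc mods by (simp add: partial_transpose_def block_def)
    finally show "mat_adjoint ?P $$ (r, c) = ?P $$ (r, c)" .
  qed (simp_all add: mat_adjoint_def partial_transpose_def)
  then show ?thesis
    by (simp add: hermitian_mat_def partial_transpose_def)
qed

definition inertia_set :: "nat \<Rightarrow> nat \<Rightarrow> (nat \<times> nat \<times> nat) set" where
  "inertia_set m n = {inertia (partial_transpose m n \<rho>) | \<rho>.
     \<rho> \<in> carrier_mat (m * n) (m * n) \<and> psd_mat \<rho> \<and>
     (\<exists>x < 0. eigenvalue (partial_transpose m n \<rho>) (complex_of_real x))}"

end

theory Submission
  imports Defs "Jordan_Normal_Form.Spectral_Radius"
begin

text \<open>A product vector \<open>a \<otimes> b\<close> gives \<open>\<rho>\<^sup>\<Gamma>\<close> the value that \<open>\<rho>\<close> takes at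
  \<open>cnj a \<otimes> b\<close>, which is nonnegative, so the span of the eigenvectors of \<open>\<rho>\<^sup>\<Gamma>\<close> with negative
  eigenvalues contains no product vector.  If there are at least \<open>2 n - 1\<close> negative eigenvalues,
  \<open>n + 1\<close> linear equations suffice to cut out a subspace of that span, so it is enough that
  \<open>n + 1\<close> bilinear equations on \<open>\<complex>\<^sup>3 \<times> \<complex>\<^sup>n\<close> have a solution \<open>(a, b)\<close> with \<open>a, b \<noteq> 0\<close>.  Put the
  coefficients into \<open>(n + 1) \<times> n\<close> matrices \<open>A\<^sub>0, A\<^sub>1, A\<^sub>2\<close>; one looks for a nonzero combination
  of them with a nontrivial kernel.  Comparing dimensions, some nonzero pair \<open>(s, t)\<close> and some
  symmetric \<open>W \<noteq> 0\<close> make \<open>P W C\<^sup>T\<close> symmetric, where \<open>P = s A\<^sub>0 + t A\<^sub>1\<close> and \<open>C = A\<^sub>2\<close>.  If \<open>C\<close>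
  is injective, then \<open>P\<close> maps the range \<open>U\<close> of \<open>W\<close> into \<open>C U\<close>, and an eigenvector of
  \<open>C\<^sup>-\<^sup>1 P\<close> on \<open>U\<close> gives the combination.\<close>

section \<open>Bilinear equations\<close>

text \<open>A singular \<open>B\<close> gives the pair \<open>(0, 1)\<close>; otherwise an
  eigenvector of the inverse of \<open>B\<close> times \<open>A\<close>, with eigenvalue
  \<open>e\<close>, gives \<open>(1, - e)\<close>.\<close>

lemma singular_pencil:
  fixes A B :: "complex mat"
  assumes A: "A \<in> carrier_mat n n" and B: "B \<in> carrier_mat n n" and n: "n > 0"
  obtains s t v where "s \<noteq> 0 \<or> t \<noteq> 0" "v \<in> carrier_vec n" "v \<noteq> 0\<^sub>v n"
    "s \<cdot>\<^sub>v (A *\<^sub>v v) + t \<cdot>\<^sub>v (B *\<^sub>v v) = 0\<^sub>v n"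
proof (cases "det B = 0")
  case True
  then obtain v where v: "v \<in> carrier_vec n" "v \<noteq> 0\<^sub>v n" "B *\<^sub>v v = 0\<^sub>v n"
    using det_0_iff_vec_prod_zero[OF B] by blast
  have "0 \<cdot>\<^sub>v (A *\<^sub>v v) + 1 \<cdot>\<^sub>v (B *\<^sub>v v) = 0\<^sub>v n"
    using A B v by (intro eq_vecI) auto
  with v that[of 0 1 v] show ?thesis by simp
next
  case False
  obtain C where C: "C \<in> carrier_mat n n" and BC: "B * C = 1\<^sub>m n"
    using det_non_zero_imp_unit[OF B False, of "()"] by (auto simp: Units_def ring_mat_simps)
  have CA: "C * A \<in> carrier_mat n n" using C A by simp
  obtain e where "e \<in> spectrum (C * A)"
    using spectrum_non_empty[OF CA n] by blast
  then obtain v where v: "v \<in> carrier_vec n" "v \<noteq> 0\<^sub>v n" and ev: "C * A *\<^sub>v v = e \<cdot>\<^sub>v v"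
    using CA by (auto simp: spectrum_def eigenvalue_def eigenvector_def)
  have "A *\<^sub>v v = (B * C) *\<^sub>v (A *\<^sub>v v)" using BC A v by simp
  also have "\<dots> = B *\<^sub>v (C * A *\<^sub>v v)"
    using A B C v by (metis assoc_mult_mat_vec mult_mat_vec_carrier)
  also have "\<dots> = e \<cdot>\<^sub>v (B *\<^sub>v v)" unfolding ev using B v by (simp add: mult_mat_vec)
  finally have AB: "A *\<^sub>v v = e \<cdot>\<^sub>v (B *\<^sub>v v)" .
  have "1 \<cdot>\<^sub>v (A *\<^sub>v v) + (- e) \<cdot>\<^sub>v (B *\<^sub>v v) = 0\<^sub>v n"
    unfolding AB using B v by (intro eq_vecI) auto
  with v that[of 1 "- e" v] show ?thesis by simp
qed

section \<open>Adjoints and left inverses\<close>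

lemma mat_adjoint_carrier: "A \<in> carrier_mat m n \<Longrightarrow> mat_adjoint A \<in> carrier_mat n m"
  by (auto simp: mat_adjoint_def)

lemma dim_mat_adjoint [simp]:
  "dim_row (mat_adjoint A) = dim_col A" "dim_col (mat_adjoint A) = dim_row A"
  by (auto simp: mat_adjoint_def)

lemma index_mat_adjoint [simp]:
  "i < dim_col A \<Longrightarrow> j < dim_row A \<Longrightarrow> mat_adjoint A $$ (i, j) = conjugate (A $$ (j, i))"
  by (simp add: mat_adjoint_def mat_of_rows_def)

lemma mat_adjoint_mult:
  fixes A B :: "complex mat"
  assumes "A \<in> carrier_mat m n" "B \<in> carrier_mat n k"
  shows "mat_adjoint (A * B) = mat_adjoint B * mat_adjoint A"
  using assms by (intro eq_matI) (auto simp: scalar_prod_def mult.commute)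

lemma mat_adjoint_adjoint [simp]: "mat_adjoint (mat_adjoint A) = A"
  by (intro eq_matI) auto

lemma scalar_prod_mat_adjoint:
  fixes A :: "complex mat"
  assumes A: "A \<in> carrier_mat m n" and x: "x \<in> carrier_vec n" and y: "y \<in> carrier_vec m"
  shows "(A *\<^sub>v x) \<bullet>c y = x \<bullet>c (mat_adjoint A *\<^sub>v y)"
proof -
  have "(A *\<^sub>v x) \<bullet>c y = (\<Sum>i<m. \<Sum>j<n. A $$ (i, j) * x $ j * cnj (y $ i))"
    using A x y by (auto simp: scalar_prod_def lessThan_atLeast0 sum_distrib_right)
  also have "\<dots> = (\<Sum>j<n. \<Sum>i<m. A $$ (i, j) * x $ j * cnj (y $ i))"
    by (rule sum.swap)
  also have "\<dots> = x \<bullet>c (mat_adjoint A *\<^sub>v y)"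
    using A x y by (auto simp: scalar_prod_def lessThan_atLeast0 sum_distrib_left mult_ac)
  finally show ?thesis .
qed

text \<open>The Gram matrix \<open>?G\<close> is invertible, because \<open>?G v = 0\<close> makes
  the squared norm of \<open>C v\<close> vanish. Its inverse times the adjoint of \<open>C\<close>
  is a left inverse.\<close>

lemma injective_mat_left_inverse:
  fixes C :: "complex mat"
  assumes C: "C \<in> carrier_mat m n"
    and inj: "\<And>v. v \<in> carrier_vec n \<Longrightarrow> C *\<^sub>v v = 0\<^sub>v m \<Longrightarrow> v = 0\<^sub>v n"
  obtains L where "L \<in> carrier_mat n m" "L * C = 1\<^sub>m n"
proof -
  let ?G = "mat_adjoint C * C"
  have G: "?G \<in> carrier_mat n n" using C by (metis mult_carrier_mat mat_adjoint_carrier)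
  have "det ?G \<noteq> 0"
  proof
    assume "det ?G = 0"
    then obtain v where v: "v \<in> carrier_vec n" "v \<noteq> 0\<^sub>v n" "?G *\<^sub>v v = 0\<^sub>v n"
      using det_0_iff_vec_prod_zero[OF G] by blast
    have "(C *\<^sub>v v) \<bullet>c (C *\<^sub>v v) = v \<bullet>c (mat_adjoint C *\<^sub>v (C *\<^sub>v v))"
      by (rule scalar_prod_mat_adjoint[OF C v(1)]) (use C v in simp)
    also have "mat_adjoint C *\<^sub>v (C *\<^sub>v v) = 0\<^sub>v n"
      using v C by (metis assoc_mult_mat_vec mat_adjoint_carrier)
    finally have "(C *\<^sub>v v) \<bullet>c (C *\<^sub>v v) = 0" using v by simp
    then have "C *\<^sub>v v = 0\<^sub>v m"
      using C v by (metis conjugate_square_eq_0_vec mult_mat_vec_carrier)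
    with inj v show False by blast
  qed
  then obtain H where H: "H \<in> carrier_mat n n" "H * ?G = 1\<^sub>m n"
    using det_non_zero_imp_unit[OF G, of "()"] by (auto simp: Units_def ring_mat_simps)
  show ?thesis
  proof (rule that)
    show "H * mat_adjoint C \<in> carrier_mat n m"
      using H C by (metis mult_carrier_mat mat_adjoint_carrier)
    show "H * mat_adjoint C * C = 1\<^sub>m n"
      using H C by (metis assoc_mult_mat mat_adjoint_carrier)
  qed
qed

text \<open>In a basis that makes \<open>K\<close> upper triangular, the first basis vector not
  killed by \<open>W\<close> is sent by \<open>W\<close> to the required \<open>v\<close>. Skipping
  the killed ones allows for dependent columns of \<open>W\<close>.\<close>

lemma invariant_range_eigenvector:
  fixes P C W K :: "complex mat"
  assumes P: "P \<in> carrier_mat m n" and C: "C \<in> carrier_mat m n"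
    and W: "W \<in> carrier_mat n k" "W \<noteq> 0\<^sub>m n k" and K: "K \<in> carrier_mat k k"
    and eq: "P * W = C * W * K"
  obtains v e where "v \<in> carrier_vec n" "v \<noteq> 0\<^sub>v n" "P *\<^sub>v v = e \<cdot>\<^sub>v (C *\<^sub>v v)"
proof -
  obtain es where es: "char_poly K = (\<Prod>a\<leftarrow>es. [:- a, 1:])"
    using char_poly_factorized[OF K] by blast
  obtain T S S' where sd: "schur_decomposition K es = (T, S, S')"
    by (cases "schur_decomposition K es") auto
  from schur_decomposition[OF K es sd]
  have sim: "similar_mat_wit K T S S'" and ut: "upper_triangular T" by auto
  from similar_mat_witD2[OF K sim]
  have T: "T \<in> carrier_mat k k" and S: "S \<in> carrier_mat k k" and S': "S' \<in> carrier_mat k k"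
    and SS': "S * S' = 1\<^sub>m k" and S'S: "S' * S = 1\<^sub>m k" and KT: "K = S * T * S'" by auto
  define V where "V = W * S"
  have V: "V \<in> carrier_mat n k" using W S by (simp add: V_def)
  have KS: "K * S = S * T"
  proof -
    have "K * S = S * T * (S' * S)" unfolding KT using S T S' by (intro assoc_mult_mat) auto
    then show ?thesis using S'S S T by simp
  qed
  have PV: "P * V = C * V * T"
  proof -
    have "P * V = P * W * S" using P W S by (simp add: V_def)
    also have "\<dots> = C * W * (K * S)" unfolding eq using C W K S by (intro assoc_mult_mat) auto
    also have "\<dots> = C * W * S * T" unfolding KS using C W S T by (intro assoc_mult_mat[symmetric]) auto
    also have "\<dots> = C * V * T" using C W S by (simp add: V_def)
    finally show ?thesis .
  qed
  have "\<exists>j. j < k \<and> col V j \<noteq> 0\<^sub>v n"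
  proof (rule ccontr)
    assume "\<not> ?thesis"
    then have z: "col V j = 0\<^sub>v n" if "j < k" for j using that by blast
    have "V = 0\<^sub>m n k"
    proof (rule eq_matI)
      fix i j assume "i < dim_row (0\<^sub>m n k)" "j < dim_col (0\<^sub>m n k)"
      then have ij: "i < n" "j < k" by simp_all
      have "V $$ (i, j) = col V j $ i" using ij V by (metis carrier_matD index_col)
      with ij z[of j] show "V $$ (i, j) = 0\<^sub>m n k $$ (i, j)" by simp
    qed (use V in auto)
    then have "W * (S * S') = 0\<^sub>m n k * S'" using W S S' by (metis assoc_mult_mat V_def)
    then show False using W S' SS' by simp
  qed
  \<comment> \<open>The least index matters: in \<open>V *\<^sub>v col T j\<close> the terms before
    \<open>j\<close> vanish because those columns of \<open>V\<close> do, and the terms after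
    \<open>j\<close> because \<open>T\<close> is upper triangular.\<close>
  then obtain j where j: "j < k" "col V j \<noteq> 0\<^sub>v n"
    and first: "\<And>i. i < j \<Longrightarrow> \<not> (i < k \<and> col V i \<noteq> 0\<^sub>v n)"
    using exists_least_iff[of "\<lambda>j. j < k \<and> col V j \<noteq> 0\<^sub>v n"] by blast
  have "V *\<^sub>v col T j = T $$ (j, j) \<cdot>\<^sub>v col V j"
  proof (rule eq_vecI)
    fix i assume "i < dim_vec (T $$ (j, j) \<cdot>\<^sub>v col V j)"
    then have i: "i < n" using V by simp
    have "(V *\<^sub>v col T j) $ i = (\<Sum>l<k. V $$ (i, l) * T $$ (l, j))"
      using i V T j by (auto simp: scalar_prod_def lessThan_atLeast0)
    also have "\<dots> = (\<Sum>l<k. if l = j then V $$ (i, j) * T $$ (j, j) else 0)"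
    proof (rule sum.cong)
      fix l assume "l \<in> {..<k}"
      then have l: "l < k" by simp
      consider "l < j" | "l = j" | "j < l" by linarith
      then show "V $$ (i, l) * T $$ (l, j) = (if l = j then V $$ (i, j) * T $$ (j, j) else 0)"
      proof cases
        case 1
        then have "col V l $ i = 0" using first[OF 1] l i by simp
        then have "V $$ (i, l) = 0" using l i V by (metis carrier_matD index_col)
        with 1 show ?thesis by simp
      next
        case 3
        then have "T $$ (l, j) = 0" using ut T l by auto
        with 3 show ?thesis by simp
      qed simp
    qed simp
    also have "\<dots> = T $$ (j, j) * V $$ (i, j)" using j by simp
    also have "\<dots> = (T $$ (j, j) \<cdot>\<^sub>v col V j) $ i"
      using i j V by simp
    finally show "(V *\<^sub>v col T j) $ i = (T $$ (j, j) \<cdot>\<^sub>v col V j) $ i" .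
  qed (use V in simp)
  moreover have "P *\<^sub>v col V j = C *\<^sub>v (V *\<^sub>v col T j)"
  proof -
    have "P *\<^sub>v col V j = col (P * V) j" using col_mult2[OF P V j(1)] by simp
    also have "\<dots> = (C * V) *\<^sub>v col T j" unfolding PV by (rule col_mult2[of _ m k]) (use C V T j in auto)
    also have "\<dots> = C *\<^sub>v (V *\<^sub>v col T j)" by (rule assoc_mult_mat_vec[of _ m n _ k]) (use C V T j in auto)
    finally show ?thesis .
  qed
  ultimately have "P *\<^sub>v col V j = T $$ (j, j) \<cdot>\<^sub>v (C *\<^sub>v col V j)"
    using mult_mat_vec[OF C, of "col V j"] col_dim[of V j] V by simp
  moreover have "col V j \<in> carrier_vec n" using col_dim[of V j] V by simp
  ultimately show ?thesis using that j by blast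
qed

text \<open>If \<open>C\<close> is injective, its transpose is surjective, so the equation says that \<open>P\<close> maps
  the range of \<open>W\<close> into its image under \<open>C\<close>.\<close>

lemma rank_drop_of_symmetric_product:
  fixes P C W :: "complex mat"
  assumes P: "P \<in> carrier_mat m n" and C: "C \<in> carrier_mat m n"
    and W: "W \<in> carrier_mat n n" "W \<noteq> 0\<^sub>m n n"
    and eq: "P * W * transpose_mat C = C * W * transpose_mat P"
  obtains s t v where "s \<noteq> 0 \<or> t \<noteq> 0" "v \<in> carrier_vec n" "v \<noteq> 0\<^sub>v n"
    "s \<cdot>\<^sub>v (P *\<^sub>v v) + t \<cdot>\<^sub>v (C *\<^sub>v v) = 0\<^sub>v m"
proof (cases "\<exists>v \<in> carrier_vec n. C *\<^sub>v v = 0\<^sub>v m \<and> v \<noteq> 0\<^sub>v n")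
  case True
  then obtain v where v: "v \<in> carrier_vec n" "C *\<^sub>v v = 0\<^sub>v m" "v \<noteq> 0\<^sub>v n" by blast
  have "0 \<cdot>\<^sub>v (P *\<^sub>v v) + 1 \<cdot>\<^sub>v (C *\<^sub>v v) = 0\<^sub>v m"
    using P C v by (intro eq_vecI) auto
  with v that[of 0 1 v] show ?thesis by simp
next
  case False
  then obtain L where L: "L \<in> carrier_mat n m" and LC: "L * C = 1\<^sub>m n"
    using injective_mat_left_inverse[OF C] by metis
  \<comment> \<open>Multiplying \<open>eq\<close> on the right by the transpose of \<open>L\<close>
    cancels the transpose of \<open>C\<close> and leaves \<open>P * W = C * W * ?K\<close>.\<close>
  let ?K = "transpose_mat P * transpose_mat L"
  have CL: "transpose_mat C * transpose_mat L = 1\<^sub>m n"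
    using transpose_mult[OF L C] LC by simp
  have "P * W * (transpose_mat C * transpose_mat L) = P * W * transpose_mat C * transpose_mat L"
    using P W C L by (intro assoc_mult_mat[symmetric]) auto
  also have "\<dots> = C * W * ?K"
    unfolding eq using P W C L by (intro assoc_mult_mat) auto
  finally have "P * W = C * W * ?K" using CL P W by simp
  moreover have "?K \<in> carrier_mat n n" using P L by simp
  ultimately obtain v e where v: "v \<in> carrier_vec n" "v \<noteq> 0\<^sub>v n" "P *\<^sub>v v = e \<cdot>\<^sub>v (C *\<^sub>v v)"
    using invariant_range_eigenvector[OF P C W] by metis
  have "1 \<cdot>\<^sub>v (P *\<^sub>v v) + (- e) \<cdot>\<^sub>v (C *\<^sub>v v) = 0\<^sub>v m"
    unfolding v(3) using C v by (intro eq_vecI) auto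
  with v that[of 1 "- e" v] show ?thesis by simp
qed

section \<open>Combinations of three matrices with a kernel\<close>

lemma index_mult_mult_transpose:
  fixes P W C :: "complex mat"
  assumes "P \<in> carrier_mat m n" "W \<in> carrier_mat n n" "C \<in> carrier_mat m n" "a < m" "b < m"
  shows "(P * W * transpose_mat C) $$ (a, b) =
    (\<Sum>i<n. \<Sum>j<n. P $$ (a, i) * C $$ (b, j) * W $$ (i, j))"
  using assms by (auto simp: scalar_prod_def lessThan_atLeast0 sum_distrib_left mult_ac)

text \<open>Sending a symmetric \<open>n \<times> n\<close> matrix \<open>W\<close> to the antisymmetric matrix
  \<open>P W C\<^sup>T - C W P\<^sup>T\<close> of size \<open>n + 1\<close> is a linear map between spaces of the same
  dimension \<open>n (n + 1) / 2\<close>, and it is bilinear in \<open>P\<close> and \<open>C\<close>.  The pairs \<open>(i, j)\<close> with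
  \<open>i \<le> j < n\<close> index the entries of \<open>W\<close>, the pairs \<open>(i, j + 1)\<close> those of the image.\<close>

lemma symmetric_product_pencil:
  fixes A0 A1 C :: "complex mat"
  assumes A0: "A0 \<in> carrier_mat (n + 1) n" and A1: "A1 \<in> carrier_mat (n + 1) n"
    and C: "C \<in> carrier_mat (n + 1) n" and n: "n > 0"
  obtains s t W where "s \<noteq> 0 \<or> t \<noteq> 0" "W \<in> carrier_mat n n" "W \<noteq> 0\<^sub>m n n"
    "(s \<cdot>\<^sub>m A0 + t \<cdot>\<^sub>m A1) * W * transpose_mat C =
     C * W * transpose_mat (s \<cdot>\<^sub>m A0 + t \<cdot>\<^sub>m A1)"
proof -
  define S where "S = {(i, j). i \<le> j \<and> j < n}"
  have finS: "finite S"
    by (rule finite_subset[of _ "{..<n} \<times> {..<n}"]) (auto simp: S_def)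
  define N where "N = card S"
  have "(0, 0) \<in> S" using n by (simp add: S_def)
  then have N: "N > 0" unfolding N_def using finS by (auto simp: card_gt_0_iff)
  \<comment> \<open>One enumeration of \<open>S\<close> numbers both the unknowns and the equations,
    so the linear map becomes a square matrix.\<close>
  obtain e where e: "bij_betw e {0..<N} S"
    using ex_bij_betw_nat_finite[OF finS] N_def by blast
  \<comment> \<open>For \<open>l < N\<close>, \<open>E l\<close> is the symmetric basis matrix with
    ones at position \<open>e l\<close> and at its mirror image.\<close>
  define E :: "nat \<Rightarrow> nat \<Rightarrow> nat \<Rightarrow> complex"
    where "E l i j = (if e l = (min i j, max i j) then 1 else 0)" for l i j
  \<comment> \<open>For \<open>e k = (a, b)\<close> this is the coefficient of
    \<open>W $$ (i, j)\<close> in entry \<open>(a, b + 1)\<close> of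
    \<open>P W C^T - C W P^T\<close>. It is linear in \<open>P\<close>, hence so is
    \<open>M\<close>.\<close>
  define f :: "complex mat \<Rightarrow> nat \<Rightarrow> nat \<Rightarrow> nat \<Rightarrow> complex"
    where "f P k i j = P $$ (fst (e k), i) * C $$ (Suc (snd (e k)), j)
      - C $$ (fst (e k), i) * P $$ (Suc (snd (e k)), j)" for P k i j
  define M where "M P = mat N N (\<lambda>(k, l). \<Sum>i<n. \<Sum>j<n. f P k i j * E l i j)" for P
  obtain s t v where st: "s \<noteq> 0 \<or> t \<noteq> 0" and v: "v \<in> carrier_vec N" "v \<noteq> 0\<^sub>v N"
    and sing: "s \<cdot>\<^sub>v (M A0 *\<^sub>v v) + t \<cdot>\<^sub>v (M A1 *\<^sub>v v) = 0\<^sub>v N"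
    using singular_pencil[of "M A0" N "M A1"] N by (auto simp: M_def)
  define W where "W = mat n n (\<lambda>(i, j). \<Sum>l<N. E l i j * v $ l)"
  have W: "W \<in> carrier_mat n n" by (simp add: W_def)
  have Wsym: "W $$ (i, j) = W $$ (j, i)" if "i < n" "j < n" for i j
    using that by (simp add: W_def E_def min.commute max.commute)
  have "W \<noteq> 0\<^sub>m n n"
  proof
    assume W0: "W = 0\<^sub>m n n"
    have "v $ k = 0" if k: "k < N" for k
    proof -
      obtain i j where ij: "e k = (i, j)" by fastforce
      have "(i, j) \<in> S" using e k ij by (metis bij_betwE atLeastLessThan_iff zero_le)
      then have le: "i \<le> j" "j < n" by (auto simp: S_def)
      \<comment> \<open>As \<open>e\<close> is injective, only \<open>l = k\<close> contributes to
        the entry of \<open>W\<close> at \<open>e k\<close>.\<close>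
      have "E l i j * v $ l = (if l = k then v $ k else 0)" if "l < N" for l
        using e that k ij le by (auto simp: E_def bij_betw_def inj_on_def)
      then have "W $$ (i, j) = (\<Sum>l<N. if l = k then v $ k else 0)"
        using le by (simp add: W_def)
      with W0 k le show ?thesis by simp
    qed
    with v show False by (auto simp: vec_eq_iff)
  qed
  define P where "P = s \<cdot>\<^sub>m A0 + t \<cdot>\<^sub>m A1"
  have P: "P \<in> carrier_mat (n + 1) n" using A0 A1 by (simp add: P_def)
  have Mv: "(M Q *\<^sub>v v) $ k = (\<Sum>i<n. \<Sum>j<n. f Q k i j * W $$ (i, j))" if "k < N" for Q k
  proof -
    have "(M Q *\<^sub>v v) $ k = (\<Sum>l<N. (\<Sum>i<n. \<Sum>j<n. f Q k i j * E l i j) * v $ l)"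
      using that v by (simp add: M_def scalar_prod_def lessThan_atLeast0)
    also have "\<dots> = (\<Sum>l<N. \<Sum>i<n. \<Sum>j<n. f Q k i j * (E l i j * v $ l))"
      by (simp add: sum_distrib_right mult.assoc)
    also have "\<dots> = (\<Sum>i<n. \<Sum>l<N. \<Sum>j<n. f Q k i j * (E l i j * v $ l))"
      by (rule sum.swap)
    also have "\<dots> = (\<Sum>i<n. \<Sum>j<n. \<Sum>l<N. f Q k i j * (E l i j * v $ l))"
      by (intro sum.cong refl sum.swap)
    also have "\<dots> = (\<Sum>i<n. \<Sum>j<n. f Q k i j * W $$ (i, j))"
      by (simp add: W_def sum_distrib_left)
    finally show ?thesis .
  qed
  define q where "q X Y a b = (\<Sum>i<n. \<Sum>j<n. X $$ (a, i) * Y $$ (b, j) * W $$ (i, j))"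
    for X Y :: "complex mat" and a b
  have qsym: "q X Y a b = q Y X b a" for X Y a b
    unfolding q_def by (subst sum.swap) (auto intro!: sum.cong simp: Wsym mult_ac)
  have q_less: "q P C a b = q C P a b" if ab: "a < b" "b \<le> n" for a b
  proof -
    have "(a, b - 1) \<in> S" using ab by (auto simp: S_def)
    then obtain k where k: "k < N" "e k = (a, b - 1)"
      using e by (metis bij_betw_iff_bijections atLeastLessThan_iff)
    have bij: "f P k i j = s * f A0 k i j + t * f A1 k i j" if "i < n" "j < n" for i j
      using that ab k A0 A1 by (simp add: f_def P_def algebra_simps)
    have "q P C a b - q C P a b = (\<Sum>i<n. \<Sum>j<n. f P k i j * W $$ (i, j))"
      using ab k by (simp add: q_def f_def sum_subtractf algebra_simps)
    also have "\<dots> = s * (\<Sum>i<n. \<Sum>j<n. f A0 k i j * W $$ (i, j))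
        + t * (\<Sum>i<n. \<Sum>j<n. f A1 k i j * W $$ (i, j))"
      by (simp add: bij sum_distrib_left sum.distrib algebra_simps)
    also have "\<dots> = (s \<cdot>\<^sub>v (M A0 *\<^sub>v v) + t \<cdot>\<^sub>v (M A1 *\<^sub>v v)) $ k"
      using k Mv[OF k(1)] by (simp add: M_def)
    finally show ?thesis using sing k by simp
  qed
  \<comment> \<open>By \<open>qsym\<close>, the entries below the diagonal follow from those above
    it; on the diagonal \<open>qsym\<close> alone gives equality.\<close>
  have q_eq: "q P C a b = q C P a b" if "a \<le> n" "b \<le> n" for a b
    using q_less[of a b] q_less[of b a] qsym[of P C a b] qsym[of C P a b] that
    by (cases a b rule: linorder_cases) auto
  have "P * W * transpose_mat C = C * W * transpose_mat P"
  proof (rule eq_matI)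
    fix a b assume "a < dim_row (C * W * transpose_mat P)" "b < dim_col (C * W * transpose_mat P)"
    then have ab: "a < n + 1" "b < n + 1" using C P by auto
    then show "(P * W * transpose_mat C) $$ (a, b) = (C * W * transpose_mat P) $$ (a, b)"
      using q_eq[of a b] unfolding index_mult_mult_transpose[OF P W C ab]
        index_mult_mult_transpose[OF C W P ab] q_def by simp
  qed (use P C in auto)
  with st W \<open>W \<noteq> 0\<^sub>m n n\<close> show ?thesis unfolding P_def by (rule that)
qed

lemma rank_drop_of_three_matrices:
  fixes A0 A1 A2 :: "complex mat"
  assumes A: "A0 \<in> carrier_mat (n + 1) n" "A1 \<in> carrier_mat (n + 1) n" "A2 \<in> carrier_mat (n + 1) n"
    and n: "n > 0"
  obtains a0 a1 a2 v where "a0 \<noteq> 0 \<or> a1 \<noteq> 0 \<or> a2 \<noteq> 0" "v \<in> carrier_vec n" "v \<noteq> 0\<^sub>v n"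
    "a0 \<cdot>\<^sub>v (A0 *\<^sub>v v) + a1 \<cdot>\<^sub>v (A1 *\<^sub>v v) + a2 \<cdot>\<^sub>v (A2 *\<^sub>v v) = 0\<^sub>v (n + 1)"
proof -
  obtain s t W where st: "s \<noteq> 0 \<or> t \<noteq> 0" and W: "W \<in> carrier_mat n n" "W \<noteq> 0\<^sub>m n n"
    and eq: "(s \<cdot>\<^sub>m A0 + t \<cdot>\<^sub>m A1) * W * transpose_mat A2 =
      A2 * W * transpose_mat (s \<cdot>\<^sub>m A0 + t \<cdot>\<^sub>m A1)"
    by (rule symmetric_product_pencil[OF A n])
  let ?P = "s \<cdot>\<^sub>m A0 + t \<cdot>\<^sub>m A1"
  have P: "?P \<in> carrier_mat (n + 1) n" using A by simp
  obtain c d v where cd: "c \<noteq> 0 \<or> d \<noteq> 0" and v: "v \<in> carrier_vec n" "v \<noteq> 0\<^sub>v n"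
    and zero: "c \<cdot>\<^sub>v (?P *\<^sub>v v) + d \<cdot>\<^sub>v (A2 *\<^sub>v v) = 0\<^sub>v (n + 1)"
    by (rule rank_drop_of_symmetric_product[OF P A(3) W eq])
  \<comment> \<open>The new coefficients are not all zero: if \<open>c = 0\<close> then
    \<open>d\<close> is nonzero, and otherwise \<open>c * s\<close> or \<open>c * t\<close>
    is.\<close>
  have "(c * s) \<cdot>\<^sub>v (A0 *\<^sub>v v) + (c * t) \<cdot>\<^sub>v (A1 *\<^sub>v v) + d \<cdot>\<^sub>v (A2 *\<^sub>v v)
      = c \<cdot>\<^sub>v (?P *\<^sub>v v) + d \<cdot>\<^sub>v (A2 *\<^sub>v v)"
    using A v by (intro eq_vecI)
      (auto simp: scalar_prod_def sum_distrib_left sum.distrib algebra_simps)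
  with zero show ?thesis using that[of "c * s" "c * t" d v] st cd v by auto
qed

section \<open>Product vectors in a kernel\<close>

lemma sum_lessThan_mult:
  fixes f :: "nat \<Rightarrow> 'a :: comm_monoid_add"
  shows "(\<Sum>r<m * n. f r) = (\<Sum>i<m. \<Sum>k<n. f (i * n + k))"
proof (induction m)
  case (Suc m)
  have "(\<Sum>r<Suc m * n. f r) = (\<Sum>r<m * n. f r) + (\<Sum>k<n. f (m * n + k))"
    using sum.atLeastLessThan_concat[of 0 "m * n" "m * n + n" f]
      sum.shift_bounds_nat_ivl[of f 0 "m * n" n]
    by (simp add: lessThan_atLeast0 add.commute)
  with Suc.IH show ?case by simp
qed simp

text \<open>Position \<open>i n + k\<close> of a vector in \<open>\<complex>\<^sup>3 \<otimes> \<complex>\<^sup>n\<close> belongs to \<open>e\<^sub>i \<otimes> e\<^sub>k\<close>;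
  the values of \<open>a\<close> from \<open>3\<close> on and those of \<open>b\<close> from \<open>n\<close> on play no role.\<close>

lemma product_vector_in_kernel:
  fixes R :: "complex mat"
  assumes R: "R \<in> carrier_mat (n + 1) (3 * n)" and n: "n > 0"
  obtains a b i j where "i < 3" "a i \<noteq> 0" "j < n" "b j \<noteq> 0"
    "R *\<^sub>v vec (3 * n) (\<lambda>r. a (r div n) * b (r mod n)) = 0\<^sub>v (n + 1)"
proof -
  \<comment> \<open>Cutting \<open>R\<close> into three blocks of \<open>n\<close> columns turns its
    value at a product vector into a combination of the blocks, with coefficients
    \<open>a i\<close>, applied to the second factor.\<close>
  define A where "A i = mat (n + 1) n (\<lambda>(r, k). R $$ (r, i * n + k))" for i
  obtain a0 a1 a2 v where a: "a0 \<noteq> 0 \<or> a1 \<noteq> 0 \<or> a2 \<noteq> 0"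
    and v: "v \<in> carrier_vec n" "v \<noteq> 0\<^sub>v n"
    and zero: "a0 \<cdot>\<^sub>v (A 0 *\<^sub>v v) + a1 \<cdot>\<^sub>v (A 1 *\<^sub>v v) + a2 \<cdot>\<^sub>v (A 2 *\<^sub>v v) = 0\<^sub>v (n + 1)"
    by (rule rank_drop_of_three_matrices[of "A 0" n "A 1" "A 2"]) (use n in \<open>auto simp: A_def\<close>)
  define a :: "nat \<Rightarrow> complex" where "a i = (if i = 0 then a0 else if i = 1 then a1 else a2)" for i
  obtain i where i: "i < 3" "a i \<noteq> 0"
    using a that[of 0] that[of 1] that[of 2] by (auto simp: a_def split: if_splits)
  obtain j where j: "j < n" "v $ j \<noteq> 0" using v by (auto simp: vec_eq_iff)
  have "R *\<^sub>v vec (3 * n) (\<lambda>r. a (r div n) * v $ (r mod n)) = 0\<^sub>v (n + 1)" (is "R *\<^sub>v ?x = _")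
  proof (rule eq_vecI)
    fix r assume "r < dim_vec (0\<^sub>v (n + 1) :: complex vec)"
    then have r: "r < n + 1" by simp
    have "(R *\<^sub>v ?x) $ r = (\<Sum>c<3 * n. R $$ (r, c) * (a (c div n) * v $ (c mod n)))"
      using R r by (simp add: scalar_prod_def lessThan_atLeast0)
    also have "\<dots> = (\<Sum>i<3. \<Sum>k<n. R $$ (r, i * n + k) * (a i * v $ k))"
      unfolding sum_lessThan_mult by (intro sum.cong) auto
    also have "\<dots> = (\<Sum>i<3. a i * (\<Sum>k<n. R $$ (r, i * n + k) * v $ k))"
      by (simp add: sum_distrib_left mult_ac)
    also have "\<dots> = (\<Sum>i<3. a i * (A i *\<^sub>v v) $ r)"
      using r v by (simp add: A_def scalar_prod_def lessThan_atLeast0)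
    also have "\<dots> = (a0 \<cdot>\<^sub>v (A 0 *\<^sub>v v) + a1 \<cdot>\<^sub>v (A 1 *\<^sub>v v) + a2 \<cdot>\<^sub>v (A 2 *\<^sub>v v)) $ r"
      using r by (simp add: A_def a_def eval_nat_numeral)
    finally show "(R *\<^sub>v ?x) $ r = 0\<^sub>v (n + 1) $ r" using zero by simp
  qed (use R in simp)
  with i j show ?thesis using that[of i a j "($) v"] by simp
qed

section \<open>Spectral theorem for Hermitian matrices\<close>

text \<open>Gram-Schmidt keeps the first vector of a basis that starts with \<open>v\<close>;
  dividing the orthogonal vectors by their norms then only rescales it.\<close>

lemma unitary_extension:
  fixes v :: "complex vec"
  assumes v: "v \<in> carrier_vec n" "v \<noteq> 0\<^sub>v n"
  obtains W c where "W \<in> carrier_mat n n" "mat_adjoint W * W = 1\<^sub>m n" "col W 0 = c \<cdot>\<^sub>v v"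
proof -
  interpret cof_vec_space n "TYPE(complex)" .
  define b where "b = basis_completion v"
  define ws where "ws = gram_schmidt n b"
  from basis_completion[OF v, folded b_def]
  have dist_b: "distinct b" and indep: "\<not> lin_dep (set b)" and b: "set b \<subseteq> carrier_vec n"
    and hdb: "hd b = v" and len_b: "length b = n" by auto
  have n: "n > 0" using v by (cases n) auto
  with len_b hdb obtain vs where bv: "b = v # vs" by (cases b) auto
  from gram_schmidt_result[OF b dist_b indep refl, folded ws_def]
  have ws: "set ws \<subseteq> carrier_vec n" "corthogonal ws" "length ws = n" by (auto simp: len_b)
  from gram_schmidt_hd[OF v(1), of vs, folded bv] have hdws: "ws ! 0 = v"
    unfolding ws_def[symmetric] using ws n by (simp add: hd_conv_nth[symmetric] flip: length_greater_0_conv)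
  define d where "d i = 1 / sqrt (Re (ws ! i \<bullet>c ws ! i))" for i
  define W where "W = mat_of_cols n (map (\<lambda>i. complex_of_real (d i) \<cdot>\<^sub>v ws ! i) [0..<n])"
  have wsi: "ws ! i \<in> carrier_vec n" if "i < n" for i using ws that by auto
  have col: "col W i = complex_of_real (d i) \<cdot>\<^sub>v ws ! i" if "i < n" for i
    unfolding W_def using that wsi[OF that] by (subst col_mat_of_cols) auto
  have W: "W \<in> carrier_mat n n" by (auto simp: W_def mat_of_cols_def)
  have "mat_adjoint W * W = 1\<^sub>m n"
  proof (rule eq_matI)
    fix i j assume "i < dim_row (1\<^sub>m n :: complex mat)" "j < dim_col (1\<^sub>m n :: complex mat)"
    then have ij: "i < n" "j < n" by auto
    have "(mat_adjoint W * W) $$ (i, j) = col W j \<bullet>c col W i"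
      using W ij by (auto simp: scalar_prod_def mult.commute intro!: sum.cong)
    also have "\<dots> = complex_of_real (d i * d j) * (ws ! j \<bullet>c ws ! i)"
      using wsi[OF ij(1)] wsi[OF ij(2)] ij by (simp add: col scalar_prod_def sum_distrib_left mult_ac)
    also have "\<dots> = (if i = j then 1 else 0)"
    proof (cases "i = j")
      case True
      have "ws ! i \<bullet>c ws ! i \<ge> 0" by (rule conjugate_square_ge_0_vec)
      moreover have "ws ! i \<bullet>c ws ! i \<noteq> 0" using corthogonalD[OF ws(2), of i i] ij ws by simp
      ultimately have r: "ws ! i \<bullet>c ws ! i = complex_of_real (Re (ws ! i \<bullet>c ws ! i))"
        "Re (ws ! i \<bullet>c ws ! i) > 0"
        by (auto simp: less_eq_complex_def complex_eq_iff)
      then have "d i * d i * Re (ws ! i \<bullet>c ws ! i) = 1" by (simp add: d_def)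
      then show ?thesis using True r(1) by (metis of_real_1 of_real_mult)
    next
      case False
      then show ?thesis using corthogonalD[OF ws(2), of j i] ij ws by simp
    qed
    finally show "(mat_adjoint W * W) $$ (i, j) = 1\<^sub>m n $$ (i, j)" using ij by simp
  qed (use W in auto)
  with W col[OF n] hdws show ?thesis using that by simp
qed

lemma hermitian_matD:
  "hermitian_mat A \<Longrightarrow> i < dim_row A \<Longrightarrow> j < dim_row A \<Longrightarrow> A $$ (i, j) = cnj (A $$ (j, i))"
  by (metis conjugate_complex_def hermitian_mat_def index_mat_adjoint square_mat.simps)

lemma mult_block_diagonal:
  fixes A B :: "'a :: semiring_1 mat"
  assumes "A \<in> carrier_mat k k" "C \<in> carrier_mat k k" "B \<in> carrier_mat m m" "D \<in> carrier_mat m m"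
  shows "four_block_mat A (0\<^sub>m k m) (0\<^sub>m m k) B * four_block_mat C (0\<^sub>m k m) (0\<^sub>m m k) D
    = four_block_mat (A * C) (0\<^sub>m k m) (0\<^sub>m m k) (B * D)"
proof -
  have "A * C \<in> carrier_mat k k" "B * D \<in> carrier_mat m m"
    using assms by (metis mult_carrier_mat)+
  then show ?thesis
    using assms by (subst mult_four_block_mat[of _ k k _ m _ m _ _ k _ m]) simp_all
qed

text \<open>Deflation: a unitary matrix whose first column is an eigenvector for the head of
  \<open>es\<close> splits off a block of size one. As \<open>es\<close> is given, the diagonal
  comes in any chosen order, which later puts the negative eigenvalues first.\<close>

lemma hermitian_unitary_diagonalization:
  fixes A :: "complex mat"
  assumes "A \<in> carrier_mat n n" "hermitian_mat A" "char_poly A = (\<Prod>e\<leftarrow>es. [:- e, 1:])"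
  shows "\<exists>U \<in> carrier_mat n n. mat_adjoint U * U = 1\<^sub>m n \<and>
    mat_adjoint U * A * U = mat n n (\<lambda>(i, j). if i = j then es ! i else 0)"
  using assms
proof (induction es arbitrary: n A)
  case Nil
  then have "n = 0" using degree_monic_char_poly[of A n] by auto
  with Nil show ?case by (intro bexI[of _ "1\<^sub>m 0"]) (auto intro!: eq_matI)
next
  case (Cons e es)
  note A = Cons.prems(1) and herm = Cons.prems(2)
  have "eigenvalue A e"
    unfolding eigenvalue_root_char_poly[OF A] Cons.prems(3) by simp
  then obtain v where v: "v \<in> carrier_vec n" "v \<noteq> 0\<^sub>v n" and ev: "A *\<^sub>v v = e \<cdot>\<^sub>v v"
    using A by (auto simp: eigenvalue_def eigenvector_def)
  obtain m where n: "n = Suc m" using v by (cases n) auto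
  obtain W c where W: "W \<in> carrier_mat n n" and WW: "mat_adjoint W * W = 1\<^sub>m n"
    and W0: "col W 0 = c \<cdot>\<^sub>v v"
    by (rule unitary_extension[OF v])
  let ?W' = "mat_adjoint W"
  have W': "?W' \<in> carrier_mat n n" using W by (rule mat_adjoint_carrier)
  define B where "B = ?W' * A * W"
  have B: "B \<in> carrier_mat n n" using A W W' by (simp add: B_def)
  have W'A: "?W' * A \<in> carrier_mat n n" using W' A by (rule mult_carrier_mat)
  have "mat_adjoint B = ?W' * (mat_adjoint A * mat_adjoint ?W')"
    unfolding B_def mat_adjoint_mult[OF W'A W] mat_adjoint_mult[OF W' A] by (rule refl)
  then have "mat_adjoint B = B"
    using herm A W W' by (simp add: hermitian_mat_def B_def)
  then have hB: "hermitian_mat B" using B by (simp add: hermitian_mat_def)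
  have B0: "B $$ (i, 0) = (if i = 0 then e else 0)" if "i < n" for i
  proof -
    have W0c: "col W 0 \<in> carrier_vec n" unfolding W0 using v by simp
    have "col B 0 = (?W' * A) *\<^sub>v col W 0"
      unfolding B_def using n by (intro col_mult2[OF W'A W]) simp
    also have "\<dots> = ?W' *\<^sub>v (A *\<^sub>v col W 0)"
      by (rule assoc_mult_mat_vec[OF W' A W0c])
    also have "A *\<^sub>v col W 0 = e \<cdot>\<^sub>v col W 0"
      unfolding W0 using A v ev by (simp add: mult_mat_vec smult_smult_assoc mult.commute)
    also have "?W' *\<^sub>v (e \<cdot>\<^sub>v col W 0) = e \<cdot>\<^sub>v (?W' *\<^sub>v col W 0)"
      by (rule mult_mat_vec[OF W' W0c])
    also have "?W' *\<^sub>v col W 0 = col (?W' * W) 0"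
      using col_mult2[OF W' W] n by simp
    finally have "col B 0 $ i = (e \<cdot>\<^sub>v col (1\<^sub>m n) 0) $ i" unfolding WW by simp
    then show ?thesis using B that n by simp
  qed
  \<comment> \<open>The Hermitian property carries the zeros of the first column over to the first
    row, so \<open>B\<close> is block diagonal.\<close>
  have B0': "B $$ (0, i) = 0" if "i < n" "i \<noteq> 0" for i
    using hermitian_matD[OF hB, of 0 i] B B0[of i] that n by simp
  define A3 where "A3 = mat m m (\<lambda>(i, j). B $$ (Suc i, Suc j))"
  have A3: "A3 \<in> carrier_mat m m" by (simp add: A3_def)
  let ?E = "mat 1 1 (\<lambda>_. e)"
  have Bblock: "B = four_block_mat ?E (0\<^sub>m 1 m) (0\<^sub>m m 1) A3"
    using B B0 B0' n by (intro eq_matI) (auto simp: A3_def)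
  have hA3: "hermitian_mat A3"
  proof -
    have "mat_adjoint A3 = A3"
    proof (rule eq_matI)
      fix i j assume "i < dim_row A3" "j < dim_col A3"
      then show "mat_adjoint A3 $$ (i, j) = A3 $$ (i, j)"
        using hermitian_matD[OF hB, of "Suc i" "Suc j"] B n by (simp add: A3_def)
    qed (simp_all add: A3_def)
    then show ?thesis by (simp add: hermitian_mat_def A3_def)
  qed
  have "similar_mat_wit B A ?W' W"
    using A B W W' WW mat_mult_left_right_inverse[OF W' W WW]
    by (intro similar_mat_witI[of _ _ n]) (auto simp: B_def)
  then have "char_poly A = char_poly B"
    by (intro char_poly_similar[symmetric]) (auto simp: similar_mat_def)
  also have "\<dots> = char_poly ?E * char_poly A3"
    unfolding Bblock by (rule char_poly_four_block_zeros_col) (use A3 in auto)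
  also have "char_poly ?E = [:- e, 1:]"
    by (simp add: char_poly_defs det_def sign_def)
  finally have "[:- e, 1:] * char_poly A3 = [:- e, 1:] * (\<Prod>e\<leftarrow>es. [:- e, 1:])"
    unfolding Cons.prems(3) by (simp only: list.map prod_list.Cons)
  \<comment> \<open>Cancelling the linear factor of \<open>e\<close> leaves the form that the
    induction hypothesis requires.\<close>
  then have "char_poly A3 = (\<Prod>e\<leftarrow>es. [:- e, 1:])"
    by (subst (asm) mult_cancel_left) simp
  from Cons.IH[OF A3 hA3 this]
  obtain U where U: "U \<in> carrier_mat m m" and UU: "mat_adjoint U * U = 1\<^sub>m m"
    and UA: "mat_adjoint U * A3 * U = mat m m (\<lambda>(i, j). if i = j then es ! i else 0)" by blast
  let ?U = "four_block_mat (1\<^sub>m 1) (0\<^sub>m 1 m) (0\<^sub>m m 1) U"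
  have bU: "?U \<in> carrier_mat n n" using U n by auto
  have adjU: "mat_adjoint ?U = four_block_mat (1\<^sub>m 1) (0\<^sub>m 1 m) (0\<^sub>m m 1) (mat_adjoint U)"
    using U by (intro eq_matI) auto
  have U'': "mat_adjoint U \<in> carrier_mat m m" using U by (rule mat_adjoint_carrier)
  have E: "?E \<in> carrier_mat 1 1" "1\<^sub>m 1 \<in> carrier_mat 1 1" by simp_all
  have bUU: "mat_adjoint ?U * ?U = 1\<^sub>m n"
    unfolding adjU mult_block_diagonal[OF E(2) E(2) U'' U] UU
    using n by (intro eq_matI) auto
  have bUB: "mat_adjoint ?U * B * ?U = mat n n (\<lambda>(i, j). if i = j then (e # es) ! i else 0)"
  proof -
    have "mat_adjoint ?U * B * ?U
        = four_block_mat (1\<^sub>m 1 * ?E * 1\<^sub>m 1) (0\<^sub>m 1 m) (0\<^sub>m m 1) (mat_adjoint U * A3 * U)"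
      unfolding adjU Bblock mult_block_diagonal[OF E(2) E(1) U'' A3]
      by (rule mult_block_diagonal) (use U U'' A3 in auto)
    then show ?thesis unfolding UA using n by (intro eq_matI) (auto simp: nth_Cons')
  qed
  have adjWU: "mat_adjoint (W * ?U) = mat_adjoint ?U * ?W'"
    using W bU by (rule mat_adjoint_mult)
  have aU: "mat_adjoint ?U \<in> carrier_mat n n" using bU by (rule mat_adjoint_carrier)
  have "mat_adjoint (W * ?U) * (W * ?U) = mat_adjoint ?U * (?W' * W) * ?U"
    unfolding adjWU using W W' bU aU by (simp add: assoc_mult_mat[of _ n n _ n _ n])
  also have "\<dots> = 1\<^sub>m n" unfolding WW right_mult_one_mat[OF aU] by (rule bUU)
  finally have "mat_adjoint (W * ?U) * (W * ?U) = 1\<^sub>m n" .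
  moreover have "mat_adjoint (W * ?U) * A * (W * ?U) = mat_adjoint ?U * B * ?U"
    unfolding adjWU B_def using A W W' bU aU by (simp add: assoc_mult_mat[of _ n n _ n _ n])
  ultimately show ?case using W bU bUB by (intro bexI[of _ "W * ?U"]) auto
qed

lemma quadratic_form_diagonalized:
  fixes A U :: "complex mat"
  assumes A: "A \<in> carrier_mat n n" and U: "U \<in> carrier_mat n n" and UU: "mat_adjoint U * U = 1\<^sub>m n"
    and diag: "mat_adjoint U * A * U = mat n n (\<lambda>(i, j). if i = j then es ! i else 0)"
    and x: "x \<in> carrier_vec n"
  shows "(A *\<^sub>v x) \<bullet>c x = (\<Sum>i<n. es ! i * of_real ((cmod ((mat_adjoint U *\<^sub>v x) $ i))\<^sup>2))"
proof -
  let ?U' = "mat_adjoint U" and ?D = "mat n n (\<lambda>(i, j). if i = j then es ! i else 0)"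
  define y where "y = ?U' *\<^sub>v x"
  have U': "?U' \<in> carrier_mat n n" using U by (rule mat_adjoint_carrier)
  have y: "y \<in> carrier_vec n" using U' x by (simp add: y_def)
  have "U * ?U' = 1\<^sub>m n" by (rule mat_mult_left_right_inverse[OF U' U UU])
  then have xy: "x = U *\<^sub>v y"
    unfolding y_def using U U' x by (metis assoc_mult_mat_vec one_mult_mat_vec)
  have "(A *\<^sub>v x) \<bullet>c x = (?U' *\<^sub>v (A *\<^sub>v x)) \<bullet>c y"
    using scalar_prod_mat_adjoint[OF U', of "A *\<^sub>v x" y] A x y xy by simp
  also have "?U' *\<^sub>v (A *\<^sub>v x) = (?U' * A * U) *\<^sub>v y"
    unfolding xy using A U U' y by (simp add: assoc_mult_mat_vec[of _ n n _ n])
  also have "((?U' * A * U) *\<^sub>v y) \<bullet>c y = (\<Sum>i<n. (?D *\<^sub>v y) $ i * cnj (y $ i))"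
    unfolding diag using y by (simp add: scalar_prod_def lessThan_atLeast0)
  also have "\<dots> = (\<Sum>i<n. es ! i * of_real ((cmod (y $ i))\<^sup>2))"
  proof (rule sum.cong)
    fix i assume "i \<in> {..<n}"
    then have i: "i < n" by simp
    have "(?D *\<^sub>v y) $ i = (\<Sum>j<n. (if i = j then es ! i else 0) * y $ j)"
      using i y by (simp add: scalar_prod_def lessThan_atLeast0)
    also have "\<dots> = (\<Sum>j<n. if j = i then es ! i * y $ i else 0)"
      by (intro sum.cong refl) simp
    also have "\<dots> = es ! i * y $ i" using i by simp
    finally show "(?D *\<^sub>v y) $ i * cnj (y $ i) = es ! i * of_real ((cmod (y $ i))\<^sup>2)"
      by (simp only: complex_norm_square mult.assoc)
  qed simp
  finally show ?thesis unfolding y_def .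
qed

section \<open>Negative eigenvalues of partial transposes\<close>

lemma order_prod_list_linear:
  fixes es :: "'a :: idom list"
  shows "order a (\<Prod>e\<leftarrow>es. [:- e, 1:]) = count_list es a"
proof (induction es)
  case (Cons e es)
  have "order a ([:- e, 1:] * (\<Prod>e\<leftarrow>es. [:- e, 1:])) =
      order a [:- e, 1:] + order a (\<Prod>e\<leftarrow>es. [:- e, 1:])"
    by (rule order_mult, unfold mult_eq_0_iff) (auto simp: prod_list_zero_iff)
  moreover have "order a [:- e, 1:] = (if e = a then 1 else 0)"
    using order_linear_power[of a "- e" 1] by simp
  ultimately show ?case using Cons.IH by simp
qed simp

text \<open>Reordering the roots does not change their product of linear factors, and
  \<open>inertia\<close> sums root orders, so \<open>p\<close> is the number of negative entries of
  the list.\<close>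

lemma eigenvalues_negative_first:
  fixes H :: "complex mat"
  assumes H: "H \<in> carrier_mat N N" and inertia: "inertia H = (p, z, q)"
  obtains es where "char_poly H = (\<Prod>e\<leftarrow>es. [:- e, 1:])" "length es = N"
    "\<And>i. i < p \<Longrightarrow> \<exists>x<0. es ! i = complex_of_real x"
proof -
  define neg where "neg e \<longleftrightarrow> (\<exists>x<0. e = complex_of_real x)" for e
  obtain fs where fs: "char_poly H = (\<Prod>e\<leftarrow>fs. [:- e, 1:])" "length fs = N"
    using char_poly_factorized[OF H] by blast
  define es where "es = filter neg fs @ filter (\<lambda>e. \<not> neg e) fs"
  have "(\<Prod>e\<leftarrow>filter neg fs. f e) * (\<Prod>e\<leftarrow>filter (\<lambda>e. \<not> neg e) fs. f e) = (\<Prod>e\<leftarrow>fs. f e)"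
    for f :: "complex \<Rightarrow> complex poly"
    by (induction fs) (auto simp: mult_ac)
  then have "(\<Prod>e\<leftarrow>es. [:- e, 1:]) = (\<Prod>e\<leftarrow>fs. [:- e, 1:])"
    by (simp only: es_def map_append prod_list.append)
  with fs have cp: "char_poly H = (\<Prod>e\<leftarrow>es. [:- e, 1:])" by simp
  have len: "length es = N"
    using sum_length_filter_compl[of neg fs] fs by (simp add: es_def)
  have ev: "eigenvalue H c \<longleftrightarrow> c \<in> set fs" for c
    unfolding eigenvalue_root_char_poly[OF H] fs by (auto simp: poly_prod_list prod_list_zero_iff)
  let ?X = "{x. eigenvalue H (complex_of_real x) \<and> x < 0}"
  have X: "complex_of_real ` ?X = set (filter neg fs)"
    by (auto simp: ev neg_def)
  have "p = (\<Sum>x\<in>?X. order (complex_of_real x) (char_poly H))"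
    using inertia by (simp add: inertia_def)
  also have "\<dots> = (\<Sum>x\<in>?X. count_list fs (complex_of_real x))"
    by (simp add: fs order_prod_list_linear)
  also have "\<dots> = (\<Sum>c\<in>complex_of_real ` ?X. count_list fs c)"
    by (subst sum.reindex) (auto simp: inj_on_def)
  \<comment> \<open>Dropping the other entries does not change the multiplicity of a negative value,
    and the multiplicities in a list add up to its length.\<close>
  also have "\<dots> = (\<Sum>c\<in>set (filter neg fs). count_list (filter neg fs) c)"
  proof -
    have "count_list (filter neg fs) c = count_list fs c" if "neg c" for c
      using that by (induction fs) auto
    then show ?thesis unfolding X by (intro sum.cong) auto
  qed
  also have "\<dots> = length (filter neg fs)"
    by (rule sum_count_set) auto
  finally have p: "p = length (filter neg fs)" .
  have "\<exists>x<0. es ! i = complex_of_real x" if "i < p" for i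
  proof -
    have "es ! i = filter neg fs ! i" using that p by (simp add: es_def nth_append)
    moreover have "filter neg fs ! i \<in> set (filter neg fs)" using that p by (intro nth_mem) simp
    ultimately show ?thesis by (simp add: neg_def)
  qed
  with cp len show ?thesis by (rule that)
qed

section \<open>Quadratic forms on product vectors\<close>

lemma quadratic_form_product_index:
  fixes A :: "complex mat"
  assumes A: "A \<in> carrier_mat (m * n) (m * n)"
  shows "(A *\<^sub>v vec (m * n) (\<lambda>r. a (r div n) * b (r mod n))) \<bullet>c vec (m * n) (\<lambda>r. a (r div n) * b (r mod n))
    = (\<Sum>i<m. \<Sum>k<n. \<Sum>j<m. \<Sum>l<n. A $$ (i * n + k, j * n + l) * (a j * b l) * cnj (a i * b k))"
proof -
  let ?x = "\<lambda>r. a (r div n) * b (r mod n)"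
  have "(A *\<^sub>v vec (m * n) ?x) \<bullet>c vec (m * n) ?x
      = (\<Sum>r<m * n. \<Sum>c<m * n. A $$ (r, c) * ?x c * cnj (?x r))"
    using A by (simp add: scalar_prod_def lessThan_atLeast0 sum_distrib_right)
  also have "\<dots> = (\<Sum>i<m. \<Sum>k<n. \<Sum>j<m. \<Sum>l<n.
      A $$ (i * n + k, j * n + l) * (a j * b l) * cnj (a i * b k))"
    unfolding sum_lessThan_mult by (intro sum.cong) auto
  finally show ?thesis .
qed

lemma partial_transpose_index:
  assumes "i < m" "j < m" "k < n" "l < n"
  shows "partial_transpose m n M $$ (i * n + k, j * n + l) = M $$ (j * n + k, i * n + l)"
proof -
  have bound: "a * n + b < m * n" if "a < m" "b < n" for a b
  proof -
    have "a * n + b < Suc a * n" using that by simp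
    also have "\<dots> \<le> m * n" using that by (intro mult_le_mono1) simp
    finally show ?thesis .
  qed
  show ?thesis
    using assms bound by (simp add: partial_transpose_def block_def)
qed

text \<open>Partial transposition exchanges the two block indices; on a product vector, conjugating
  the first factor has the same effect.\<close>

lemma partial_transpose_quadratic_form_product:
  fixes M :: "complex mat" and a b :: "nat \<Rightarrow> complex"
  assumes M: "M \<in> carrier_mat (m * n) (m * n)"
  defines "x \<equiv> vec (m * n) (\<lambda>r. a (r div n) * b (r mod n))"
    and "y \<equiv> vec (m * n) (\<lambda>r. cnj (a (r div n)) * b (r mod n))"
  shows "(partial_transpose m n M *\<^sub>v x) \<bullet>c x = (M *\<^sub>v y) \<bullet>c y"
proof -
  let ?F = "\<lambda>i k j l. M $$ (i * n + k, j * n + l) * (cnj (a j) * b l) * cnj (cnj (a i) * b k)"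
  have "(partial_transpose m n M *\<^sub>v x) \<bullet>c x = (\<Sum>i<m. \<Sum>k<n. \<Sum>j<m. \<Sum>l<n. ?F j k i l)"
    unfolding x_def quadratic_form_product_index[OF partial_transpose_carrier]
    by (intro sum.cong) (auto simp: partial_transpose_index mult_ac)
  \<comment> \<open>Three exchanges of sums swap the roles of \<open>i\<close> and
    \<open>j\<close>.\<close>
  also have "\<dots> = (\<Sum>i<m. \<Sum>j<m. \<Sum>k<n. \<Sum>l<n. ?F j k i l)"
    by (intro sum.cong refl sum.swap)
  also have "\<dots> = (\<Sum>j<m. \<Sum>i<m. \<Sum>k<n. \<Sum>l<n. ?F j k i l)"
    by (rule sum.swap)
  also have "\<dots> = (\<Sum>j<m. \<Sum>k<n. \<Sum>i<m. \<Sum>l<n. ?F j k i l)"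
    by (intro sum.cong refl sum.swap)
  also have "\<dots> = (M *\<^sub>v y) \<bullet>c y"
    unfolding y_def by (rule quadratic_form_product_index[OF M, symmetric])
  finally show ?thesis .
qed

text \<open>With \<open>2 * n - 1\<close> negative eigenvalues, the span of their eigenvectors would
  contain a nonzero product vector. For \<open>n = 4\<close> the bound is 6, while all six excluded
  triples have at least 7 negative eigenvalues.\<close>

lemma negative_inertia_le:
  assumes "(p, z, q) \<in> inertia_set 3 n" and n: "n > 0"
  shows "p \<le> 2 * (n - 1)"
proof (rule ccontr)
  assume "\<not> p \<le> 2 * (n - 1)"
  then have p: "2 * n - 1 \<le> p" using n by simp
  obtain M where M: "M \<in> carrier_mat (3 * n) (3 * n)" and psd: "psd_mat M"
    and inert: "inertia (partial_transpose 3 n M) = (p, z, q)"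
    using assms by (auto simp: inertia_set_def)
  define H where "H = partial_transpose 3 n M"
  have H: "H \<in> carrier_mat (3 * n) (3 * n)" by (simp add: H_def)
  have herm: "hermitian_mat H"
    unfolding H_def using M psd by (intro hermitian_partial_transpose) (auto simp: psd_mat_def)
  obtain es where cp: "char_poly H = (\<Prod>e\<leftarrow>es. [:- e, 1:])"
    and neg: "\<And>i. i < p \<Longrightarrow> \<exists>x<0. es ! i = complex_of_real x"
    using eigenvalues_negative_first[OF H inert[folded H_def]] by blast
  obtain U where U: "U \<in> carrier_mat (3 * n) (3 * n)" and UU: "mat_adjoint U * U = 1\<^sub>m (3 * n)"
    and diag: "mat_adjoint U * H * U = mat (3 * n) (3 * n) (\<lambda>(i, j). if i = j then es ! i else 0)"
    using hermitian_unitary_diagonalization[OF H herm cp] by blast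
  have U': "mat_adjoint U \<in> carrier_mat (3 * n) (3 * n)" using U by (rule mat_adjoint_carrier)
  \<comment> \<open>These are the last \<open>n + 1\<close> rows of the adjoint of \<open>U\<close>;
    a vector killed by them lies in the span of the first \<open>2 * n - 1\<close> columns of
    \<open>U\<close>.\<close>
  define R where "R = mat (n + 1) (3 * n) (\<lambda>(r, c). mat_adjoint U $$ (2 * n - 1 + r, c))"
  have R: "R \<in> carrier_mat (n + 1) (3 * n)" by (simp add: R_def)
  obtain a b i j where ij: "i < 3" "a i \<noteq> 0" "j < n" "b j \<noteq> 0"
    and Rx: "R *\<^sub>v vec (3 * n) (\<lambda>r. a (r div n) * b (r mod n)) = 0\<^sub>v (n + 1)"
    by (rule product_vector_in_kernel[OF R n])
  define x where "x = vec (3 * n) (\<lambda>r. a (r div n) * b (r mod n))"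
  define y where "y = mat_adjoint U *\<^sub>v x"
  have x: "x \<in> carrier_vec (3 * n)" by (simp add: x_def)
  have y: "y \<in> carrier_vec (3 * n)" using U' x by (simp add: y_def)
  have y0: "y $ k = 0" if k: "2 * n - 1 \<le> k" "k < 3 * n" for k
  proof -
    have r: "k - (2 * n - 1) < n + 1" using k n by linarith
    have "y $ k = (R *\<^sub>v x) $ (k - (2 * n - 1))"
      unfolding y_def using r k U x by (simp add: R_def scalar_prod_def)
    then show ?thesis using Rx r by (simp add: x_def)
  qed
  \<comment> \<open>The negated terms of the diagonalized form: nonnegative below
    \<open>2 * n - 1\<close> by the sign of \<open>es ! k\<close>, and zero from there on because
    \<open>y $ k = 0\<close>. Nonnegativity of the form then forces all of them to vanish.\<close>
  define g where "g k = - Re (es ! k * of_real ((cmod (y $ k))\<^sup>2))" for k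
  have g: "g k \<ge> 0 \<and> (g k = 0 \<longrightarrow> y $ k = 0)" if k: "k < 3 * n" for k
  proof (cases "k < 2 * n - 1")
    case True
    then obtain e where "e < 0" "es ! k = complex_of_real e" using neg[of k] p by auto
    then show ?thesis by (auto simp: g_def mult_le_0_iff)
  next
    case False
    then show ?thesis using y0[of k] k by (simp add: g_def)
  qed
  have "0 \<le> (H *\<^sub>v x) \<bullet>c x"
    unfolding H_def x_def partial_transpose_quadratic_form_product[OF M]
    using psd M by (simp add: psd_mat_def)
  also have "(H *\<^sub>v x) \<bullet>c x = (\<Sum>k<3 * n. es ! k * of_real ((cmod (y $ k))\<^sup>2))"
    unfolding y_def by (rule quadratic_form_diagonalized[OF H U UU diag x])
  finally have "(\<Sum>k<3 * n. g k) \<le> 0"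
    by (simp add: less_eq_complex_def g_def sum_negf)
  then have "(\<Sum>k<3 * n. g k) = 0" using g by (intro antisym sum_nonneg) auto
  then have "\<forall>k<3 * n. g k = 0" using g by (subst (asm) sum_nonneg_eq_0_iff) auto
  then have "y = 0\<^sub>v (3 * n)" using g y by (intro eq_vecI) auto
  moreover have "x = U *\<^sub>v y"
    unfolding y_def using U U' x mat_mult_left_right_inverse[OF U' U UU]
    by (metis assoc_mult_mat_vec one_mult_mat_vec)
  ultimately have x0: "x = 0\<^sub>v (3 * n)" using U by auto
  \<comment> \<open>At this position \<open>x\<close> has the nonzero entry
    \<open>a i * b j\<close>, which contradicts \<open>x0\<close>.\<close>
  have idx: "i * n + j < 3 * n"
  proof -
    have "i * n + j < Suc i * n" using ij by simp
    also have "\<dots> \<le> 3 * n" using ij by (intro mult_le_mono1) simp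
    finally show ?thesis .
  qed
  have "a i * b j = x $ (i * n + j)" using ij idx by (simp add: x_def)
  also have "\<dots> = 0" using x0 idx by simp
  finally show False using ij by simp
qed

theorem theorem23:
  shows "((7, 0, 5) \<notin> inertia_set 3 4)
    \<and> ((7, 1, 4) \<notin> inertia_set 3 4 \<and> (7, 2, 3) \<notin> inertia_set 3 4)
    \<and> ((8, 0, 4) \<notin> inertia_set 3 4 \<and> (8, 1, 3) \<notin> inertia_set 3 4
      \<and> (9, 0, 3) \<notin> inertia_set 3 4)"
  by (auto dest: negative_inertia_le)

end
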